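(* Let $m>1$ and $n\ge1$ be integers. A composition $C=(c_1,\dots,c_k)$ of $n$ belongs to $SP(n,m)$ if and only if the values $x_m(c_1),\dots,x_m(c_k)$ are pairwise distinct and the sequence $(x_m(c_1),\dots,x_m(c_k))$ is unimodal.
   Context: For a positive integer $N$, $x_m(N)$ denotes the largest power of $m$ dividing $N$ (the power itself, e.g. $x_2(50)=2$, $x_5(216)=1$). A sequence is unimodal if it is first increasing and then decreasing (either portion may be empty). Semi-$m$-Pell compositions: $SP(n,m)=\{(n)\}$ for $1\le n\le m$; if $n>m$ and $m\mid n$, $SP(n,m)$ consists of the compositions in $SP(n/m,m)$ with every part multiplied by $m$; if $n>m$ and $n\equiv r\pmod m$, $1\le r\le m-1$, $SP(n,m)$ consists of the compositions obtained by inserting a part $r$ at the beginning or end of each composition in $SP(n-r,m)$, together with those obtained from each composition in $SP(n-m,m)$ by adding $m$ to its (unique) part congruent to $r$ mod $m$. *)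

theory Defs
  imports "HOL-Computational_Algebra.Primes"
begin

definition composition_of :: "nat \<Rightarrow> nat list \<Rightarrow> bool" where
  "composition_of n C \<longleftrightarrow> (\<forall>c\<in>set C. c > 0) \<and> sum_list C = n"

text \<open>\<^term>\<open>max_pow m N\<close> is \<open>x\<^sub>m(N)\<close>: the power itself, not its exponent. The base \<open>m\<close>
  need not be prime.\<close>

definition max_pow :: "nat \<Rightarrow> nat \<Rightarrow> nat" where
  "max_pow m N = m ^ multiplicity m N"

definition unimodal :: "'a::linorder list \<Rightarrow> bool" where
  "unimodal xs \<longleftrightarrow>
     (\<exists>us vs. xs = us @ vs \<and> sorted_wrt (\<le>) us \<and> sorted_wrt (\<ge>) vs)"

text \<open>The semi-\<open>m\<close>-Pell compositions of \<open>n\<close>. Only \<open>m > 1\<close> and \<open>n \<ge> 1\<close> are meaningful; the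
  value outside this range is a junk value that makes the recursion terminate. In the last
  set, \<open>c\<close> is the only part of the composition that is congruent to \<open>r\<close>, by
  \<open>SP_unique_part\<close> below.\<close>

function SP :: "nat \<Rightarrow> nat \<Rightarrow> nat list set" where
  "SP n m =
     (if m \<le> 1 \<or> n = 0 then {}
      else if n \<le> m then {[n]}
      else if m dvd n then map (\<lambda>c. m * c) ` SP (n div m) m
      else let r = n mod m in
        (\<lambda>C. r # C) ` SP (n - r) m
        \<union> (\<lambda>C. C @ [r]) ` SP (n - r) m
        \<union> {us @ (c + m) # vs |us c vs. us @ c # vs \<in> SP (n - m) m \<and> c mod m = r})"
  by pat_completeness auto
termination
  by (relation "measure fst") (auto simp: mod_greater_zero_iff_not_dvd)

declare SP.simps [simp del]

lemma SP_divisible_parts: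
  assumes "C \<in> SP n m" and "m dvd n" and "c \<in> set C"
  shows "m dvd c"
proof -
  have "n = m" if "n \<le> m" "n \<noteq> 0"
    using that assms(2) by (simp add: dvd_imp_le le_antisym)
  then show ?thesis
    using assms by (subst (asm) SP.simps) (auto split: if_splits)
qed

lemma SP_unique_part:
  assumes "C \<in> SP n m" and "\<not> m dvd n"
  shows "\<exists>us c vs. C = us @ c # vs \<and> c mod m = n mod m \<and> (\<forall>d\<in>set us \<union> set vs. m dvd d)"
  using assms
proof (induction n m arbitrary: C rule: SP.induct)
  case (1 n m)
  define r where "r = n mod m"
  have "m > 1" "n > 0" using "1.prems"(1) by (auto simp: SP.simps[of n m] split: if_splits)
  show ?case
  proof (cases "n \<le> m")
    case True
    then have "C = [n]"
      using "1.prems" \<open>m > 1\<close> \<open>n > 0\<close> by (simp add: SP.simps[of n m])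
    then have "C = [] @ n # []" by simp
    then show ?thesis by fastforce
  next
    case False
    have dvd: "m dvd n - r" by (simp add: r_def)
    consider D where "C = r # D" "D \<in> SP (n - r) m"
      | D where "C = D @ [r]" "D \<in> SP (n - r) m"
      | us c vs where "C = us @ (c + m) # vs" "us @ c # vs \<in> SP (n - m) m" "c mod m = r"
      using "1.prems" False \<open>m > 1\<close> \<open>n > 0\<close>
      by (subst (asm) SP.simps[of n m]) (auto simp: Let_def r_def)
    then show ?thesis
    proof cases
      case 1
      then have "C = [] @ r # D" by simp
      moreover have "\<forall>d\<in>set [] \<union> set D. m dvd d"
        using SP_divisible_parts[OF 1(2) dvd] by simp
      ultimately show ?thesis by (metis mod_mod_trivial r_def)
    next
      case 2
      moreover have "\<forall>d\<in>set D \<union> set []. m dvd d"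
        using SP_divisible_parts[OF 2(2) dvd] by simp
      ultimately show ?thesis by (metis mod_mod_trivial r_def)
    next
      case 3
      have ndvd: "\<not> m dvd n - m" using "1.prems"(2) False by (simp add: dvd_minus_self)
      have IH: "\<exists>us' c' vs'. us @ c # vs = us' @ c' # vs' \<and> c' mod m = (n - m) mod m
                  \<and> (\<forall>d\<in>set us' \<union> set vs'. m dvd d)"
        using "1.IH"(4)[OF _ _ _ refl 3(2) ndvd] False \<open>m > 1\<close> \<open>n > 0\<close> "1.prems"(2) by auto
      then obtain us' c' vs' where *: "us @ c # vs = us' @ c' # vs'"
          "\<forall>d\<in>set us' \<union> set vs'. m dvd d" by blast
      have "\<not> m dvd c" using 3(3) "1.prems"(2) by (simp add: r_def dvd_eq_mod_eq_0)
      then have "c \<notin> set us'" "c \<notin> set vs'" using *(2) by auto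
      then have "us = us' \<and> vs = vs'"
        using *(1) by (auto simp: append_eq_append_conv2 append_eq_Cons_conv Cons_eq_append_conv)
      then have "\<forall>d\<in>set us \<union> set vs. m dvd d" using *(2) by simp
      moreover have "(c + m) mod m = n mod m" using 3(3) by (simp add: r_def)
      ultimately show ?thesis using 3(1) by blast
    qed
  qed
qed

end

theory Submission
  imports Defs
begin

text \<open>
  Two parts not divisible by \<open>m\<close> both have \<open>m\<close>-power 1, so distinctness of the powers forces all
  parts to be divisible by \<open>m\<close> when \<open>m dvd n\<close>, and exactly one part to be non-divisible (hence
  congruent to \<open>n\<close>) otherwise. In the first case dividing all parts by \<open>m\<close> scales the power
  sequence. In the second, the exceptional part carries the strict minimum of the power sequence.
  Subtracting \<open>m\<close> from it, if it is larger than \<open>m\<close>, leaves the powers unchanged; otherwise it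
  equals \<open>n mod m\<close>, and unimodality holds iff it sits at one of the two ends and the rest
  is unimodal. These are exactly the recursion steps of \<open>SP\<close>.
\<close>

section \<open>Powers of \<open>m\<close> dividing a single part\<close>

lemma max_pow_mult_self:
  assumes "m > 1" "c > 0"
  shows "max_pow m (m * c) = m * max_pow m c"
  using assms by (simp add: max_pow_def multiplicity_times_same)

lemma max_pow_not_dvd: "\<not> m dvd c \<Longrightarrow> max_pow m c = 1"
  by (simp add: max_pow_def not_dvd_imp_multiplicity_0)

lemma max_pow_dvd_gt_1:
  assumes "m > 1" "c > 0" "m dvd c"
  shows "max_pow m c > 1"
proof -
  have "multiplicity m c > 0"
    using assms by (simp add: multiplicity_gt_zero_iff)
  then show ?thesis
    using assms(1) unfolding max_pow_def by (intro one_less_power)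
qed

section \<open>Unimodal sequences and their minima\<close>

lemma unimodal_map_strict_mono:
  fixes f :: "'a::linorder \<Rightarrow> 'b::linorder"
  assumes "strict_mono f"
  shows "unimodal (map f xs) \<longleftrightarrow> unimodal xs"
proof -
  have le: "f x \<le> f y \<longleftrightarrow> x \<le> y" for x y
    using assms by (rule strict_mono_less_eq)
  show ?thesis
  proof
    assume "unimodal (map f xs)"
    then show "unimodal xs"
      unfolding unimodal_def map_eq_append_conv by (auto simp: sorted_wrt_map le) blast
  next
    assume "unimodal xs"
    then obtain us vs where "xs = us @ vs" "sorted_wrt (\<le>) us" "sorted_wrt (\<ge>) vs"
      unfolding unimodal_def by blast
    then have "map f xs = map f us @ map f vs" "sorted_wrt (\<le>) (map f us)"
      "sorted_wrt (\<ge>) (map f vs)"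
      by (auto simp: sorted_wrt_map le)
    then show "unimodal (map f xs)" unfolding unimodal_def by blast
  qed
qed

text \<open>Deleting an entry only shortens the monotone run that contains it. This supplies the
  easy direction of the two equivalences on adjoining a minimum.\<close>

lemma unimodal_append_ConsD:
  assumes "unimodal (us @ a # vs)"
  shows "unimodal (us @ vs)"
proof -
  obtain ps qs where *: "us @ a # vs = ps @ qs" "sorted_wrt (\<le>) ps" "sorted_wrt (\<ge>) qs"
    using assms unfolding unimodal_def by blast
  \<comment> \<open>The entry \<open>a\<close> lies in the decreasing run \<open>qs\<close> or in
    the increasing run \<open>ps\<close>.\<close>
  from *(1) consider ws where "us = ps @ ws" "qs = ws @ a # vs"
    | ws where "ps = us @ a # ws" "vs = ws @ qs"
    by (auto simp: append_eq_append_conv2 Cons_eq_append_conv append_eq_Cons_conv)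
  then show ?thesis
  proof cases
    case 1
    then have "us @ vs = ps @ (ws @ vs)" "sorted_wrt (\<ge>) (ws @ vs)"
      using *(3) by (auto simp: sorted_wrt_append)
    then show ?thesis using *(2) unfolding unimodal_def by blast
  next
    case 2
    then have "us @ vs = (us @ ws) @ qs" "sorted_wrt (\<le>) (us @ ws)"
      using *(2) by (auto simp: sorted_wrt_append)
    then show ?thesis using *(3) unfolding unimodal_def by blast
  qed
qed

lemma unimodal_Cons_min:
  assumes "\<forall>x\<in>set xs. a \<le> x"
  shows "unimodal (a # xs) \<longleftrightarrow> unimodal xs"
proof
  assume "unimodal (a # xs)"
  then show "unimodal xs" using unimodal_append_ConsD[of "[]"] by simp
next
  assume "unimodal xs"
  then obtain us vs where *: "xs = us @ vs" "sorted_wrt (\<le>) us" "sorted_wrt (\<ge>) vs"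
    unfolding unimodal_def by blast
  then have "a # xs = (a # us) @ vs" "sorted_wrt (\<le>) (a # us)" using assms by auto
  then show "unimodal (a # xs)" using *(3) unfolding unimodal_def by blast
qed

lemma unimodal_snoc_min:
  assumes "\<forall>x\<in>set xs. a \<le> x"
  shows "unimodal (xs @ [a]) \<longleftrightarrow> unimodal xs"
proof
  assume "unimodal (xs @ [a])"
  then show "unimodal xs" using unimodal_append_ConsD[of xs a "[]"] by simp
next
  assume "unimodal xs"
  then obtain us vs where *: "xs = us @ vs" "sorted_wrt (\<le>) us" "sorted_wrt (\<ge>) vs"
    unfolding unimodal_def by blast
  then have "xs @ [a] = us @ (vs @ [a])" "sorted_wrt (\<ge>) (vs @ [a])"
    using assms by (auto simp: sorted_wrt_append)
  then show "unimodal (xs @ [a])" using *(2) unfolding unimodal_def by blast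
qed

text \<open>In the increasing run, \<open>a\<close> bounds everything before it from above; in the
  decreasing run, everything after it. A strict minimum can therefore have nothing on that
  side.\<close>

lemma unimodal_strict_min_at_end:
  assumes "unimodal (us @ a # vs)" "\<forall>x\<in>set us \<union> set vs. a < x"
  shows "us = [] \<or> vs = []"
proof (rule ccontr)
  assume ne: "\<not> ?thesis"
  obtain ps qs where *: "us @ a # vs = ps @ qs" "sorted_wrt (\<le>) ps" "sorted_wrt (\<ge>) qs"
    using assms unfolding unimodal_def by blast
  from *(1) consider ws where "us = ps @ ws" "qs = ws @ a # vs"
    | ws where "ps = us @ a # ws" "vs = ws @ qs"
    by (auto simp: append_eq_append_conv2 Cons_eq_append_conv append_eq_Cons_conv)
  then show False
  proof cases
    case 1
    then have "hd vs \<le> a" using *(3) ne by (auto simp: sorted_wrt_append)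
    moreover have "a < hd vs" using assms(2) ne by simp
    ultimately show False by simp
  next
    case 2
    then have "hd us \<le> a" using *(2) ne by (auto simp: sorted_wrt_append)
    moreover have "a < hd us" using assms(2) ne by simp
    ultimately show False by simp
  qed
qed

section \<open>Divisibility of the parts by \<open>m\<close>\<close>

lemma dvd_sum_list:
  fixes m :: "'a::comm_semiring_1"
  assumes "\<forall>x\<in>set xs. m dvd x"
  shows "m dvd sum_list xs"
  using assms by (induction xs) auto

lemma distinct_max_pow_others_dvd:
  assumes "distinct (map (max_pow m) (us @ c # vs))" "\<not> m dvd c" "d \<in> set us \<union> set vs"
  shows "m dvd d"
proof (rule ccontr)
  assume "\<not> m dvd d"
  then have "max_pow m d = max_pow m c" using assms(2) by (simp add: max_pow_not_dvd)
  then show False using assms(1,3) by (auto simp: rev_image_eqI)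
qed

text \<open>Each case also records whether \<open>m dvd n\<close>, so that the branch of the
  recursion of \<open>SP\<close> selects the matching case.\<close>

lemma distinct_max_pow_cases:
  assumes "composition_of n C" "distinct (map (max_pow m) C)"
  obtains (all_dvd) "m dvd n" "\<forall>c\<in>set C. m dvd c"
  | (one_not_dvd) us c vs where "C = us @ c # vs" "\<not> m dvd c" "c mod m = n mod m" "\<not> m dvd n"
      "\<forall>d\<in>set us \<union> set vs. m dvd d"
proof (cases "\<forall>c\<in>set C. m dvd c")
  case True
  then show ?thesis using assms(1) dvd_sum_list all_dvd by (auto simp: composition_of_def)
next
  case False
  then obtain us c vs where C: "C = us @ c # vs" "\<not> m dvd c" by (metis split_list)
  then have others: "\<forall>d\<in>set us \<union> set vs. m dvd d"
    using assms(2) distinct_max_pow_others_dvd by blast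
  \<comment> \<open>The parts other than \<open>c\<close> contribute 0 modulo \<open>m\<close>, so
    \<open>c\<close> alone determines the residue of \<open>n\<close>.\<close>
  then have "m dvd sum_list us + sum_list vs" by (auto intro!: dvd_add dvd_sum_list)
  moreover have n: "n = (sum_list us + sum_list vs) + c"
    using assms(1) C by (simp add: composition_of_def)
  ultimately have mod: "c mod m = n mod m" by (auto elim!: dvdE)
  then have "\<not> m dvd n" using C(2) by (simp add: dvd_eq_mod_eq_0)
  then show ?thesis using one_not_dvd C mod others by blast
qed

section \<open>Effect of the recursion steps on the power sequence\<close>

text \<open>Bundling both conditions lets each recursion step carry them over by a single
  equivalence.\<close>

definition distinct_unimodal :: "'a::linorder list \<Rightarrow> bool" where
  "distinct_unimodal xs \<longleftrightarrow> distinct xs \<and> unimodal xs"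

lemma distinct_unimodal_Cons_less:
  assumes "\<forall>x\<in>set xs. a < x"
  shows "distinct_unimodal (a # xs) \<longleftrightarrow> distinct_unimodal xs"
  using assms unimodal_Cons_min[of xs a] by (auto simp: distinct_unimodal_def less_imp_le)

lemma distinct_unimodal_snoc_less:
  assumes "\<forall>x\<in>set xs. a < x"
  shows "distinct_unimodal (xs @ [a]) \<longleftrightarrow> distinct_unimodal xs"
  using assms unimodal_snoc_min[of xs a] by (auto simp: distinct_unimodal_def less_imp_le)

text \<open>The powers are all multiplied by \<open>m\<close>, which is an order embedding.
  Positivity matters: \<open>max_pow m 0\<close> is 1 by convention, so the part 0 would not
  scale.\<close>

lemma distinct_unimodal_max_pow_mult:
  assumes "m > 1" "\<forall>d\<in>set D. d > 0"
  shows "distinct_unimodal (map (max_pow m) (map (\<lambda>c. m * c) D))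
    \<longleftrightarrow> distinct_unimodal (map (max_pow m) D)"
proof -
  have mono: "strict_mono (\<lambda>x::nat. m * x)"
    using assms(1) by (simp add: strict_mono_def)
  have "map (max_pow m) (map (\<lambda>c. m * c) D) = map (\<lambda>x. m * x) (map (max_pow m) D)"
    using assms by (simp add: max_pow_mult_self)
  then show ?thesis
    using unimodal_map_strict_mono[OF mono] strict_mono_imp_inj_on[OF mono]
    by (simp only: distinct_unimodal_def distinct_map[of "\<lambda>x. m * x"]) (meson inj_on_subset subset_UNIV)
qed

text \<open>Base case of the recursion: a positive multiple of \<open>m\<close> already exhausts
  \<open>n \<le> m\<close> and leaves no room for another part, while distinctness forbids two parts
  not divisible by \<open>m\<close>.\<close>

lemma composition_le_iff_singleton:
  assumes "m > 1" "n \<ge> 1" "n \<le> m" "composition_of n C"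
  shows "C = [n] \<longleftrightarrow> distinct_unimodal (map (max_pow m) C)"
proof
  assume "C = [n]"
  then show "distinct_unimodal (map (max_pow m) C)"
    by (simp add: distinct_unimodal_def unimodal_Cons_min) (simp add: unimodal_def)
next
  assume "distinct_unimodal (map (max_pow m) C)"
  then have dist: "distinct (map (max_pow m) C)" by (simp add: distinct_unimodal_def)
  have pos: "\<forall>c\<in>set C. c > 0" and sum: "sum_list C = n"
    using assms(4) by (auto simp: composition_of_def)
  have ge: "sum_list (us @ vs) \<ge> m"
    if "us @ vs \<noteq> []" "\<forall>d\<in>set us \<union> set vs. m dvd d \<and> d > 0" for us vs :: "nat list"
  proof -
    from that(1) have d: "hd (us @ vs) \<in> set (us @ vs)" by (rule hd_in_set)
    then have "m \<le> hd (us @ vs)" using that(2) by (metis dvd_imp_le set_append)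
    then show ?thesis using member_le_sum_list[OF d] by linarith
  qed
  from assms(4) dist show "C = [n]"
  proof (cases rule: distinct_max_pow_cases)
    case all_dvd
    obtain c D where C: "C = c # D" using sum assms(2) by (cases C) auto
    have "c \<ge> m" using C all_dvd pos by (simp add: dvd_imp_le)
    then have "sum_list D = 0"
      using C sum assms(3) by (simp del: sum_list_eq_0_iff)
    then have "D = []" using C pos by (cases D) auto
    then show ?thesis using C sum by simp
  next
    case (one_not_dvd us c vs)
    have "us @ vs = []"
    proof (rule ccontr)
      assume "us @ vs \<noteq> []"
      then have "sum_list (us @ vs) \<ge> m" using ge one_not_dvd pos by auto
      then show False using one_not_dvd(1) pos sum assms(3) by auto
    qed
    then show ?thesis using one_not_dvd(1) sum by simp
  qed
qed

section \<open>Induction along the recursion of \<open>SP\<close>\<close>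

lemma SP_iff_distinct_unimodal:
  assumes "m > 1" "n \<ge> 1" "composition_of n C"
  shows "C \<in> SP n m \<longleftrightarrow> distinct_unimodal (map (max_pow m) C)"
  using assms(2,3)
proof (induction n arbitrary: C rule: less_induct)
  case (less n)
  have pos: "\<forall>c\<in>set C. c > 0" and sum: "sum_list C = n"
    using less.prems(2) by (auto simp: composition_of_def)
  consider "n \<le> m" | "n > m" "m dvd n" | "n > m" "\<not> m dvd n" by linarith
  then show ?case
  proof cases
    case 1
    then have "SP n m = {[n]}" using assms(1) less.prems(1) by (simp add: SP.simps[of n m])
    then show ?thesis
      using composition_le_iff_singleton[OF assms(1) less.prems(1) 1 less.prems(2)] by simp
  next
    case 2
    have SP: "SP n m = map (\<lambda>c. m * c) ` SP (n div m) m"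
      using 2 assms(1) by (simp add: SP.simps[of n m])
    have step: "D \<in> SP (n div m) m \<longleftrightarrow> distinct_unimodal (map (max_pow m) C)"
      if D: "C = map (\<lambda>c. m * c) D" for D
    proof -
      have posD: "\<forall>d\<in>set D. d > 0" using pos D by auto
      have "n = m * sum_list D" using sum D by (simp add: sum_list_const_mult)
      then have "composition_of (n div m) D"
        using posD assms(1) by (simp add: composition_of_def)
      moreover have "n div m < n" "n div m \<ge> 1"
        using 2 assms(1) by (auto simp: div_greater_zero_iff Suc_le_eq)
      ultimately show ?thesis
        using less.IH distinct_unimodal_max_pow_mult[OF assms(1) posD] D by blast
    qed
    show ?thesis
    proof
      assume "C \<in> SP n m"
      then show "distinct_unimodal (map (max_pow m) C)" using SP step by blast
    next
      assume du: "distinct_unimodal (map (max_pow m) C)"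
      then have "distinct (map (max_pow m) C)" by (simp add: distinct_unimodal_def)
      with less.prems(2) have "\<forall>c\<in>set C. m dvd c"
        by (cases rule: distinct_max_pow_cases) (use 2 in auto)
      \<comment> \<open>Division by \<open>m\<close> is exact on every part, which provides the
        preimage \<open>D\<close> required by \<open>step\<close>.\<close>
      then have "C = map (\<lambda>c. m * c) (map (\<lambda>c. c div m) C)"
        by (simp add: map_idI)
      then show "C \<in> SP n m" using SP step du by blast
    qed
  next
    case 3
    define r where "r = n mod m"
    have r: "r > 0" "r < m" "\<not> m dvd r"
      using 3 assms(1) by (auto simp: r_def dvd_eq_mod_eq_0)
    have dvd: "m dvd n - r" by (simp add: r_def)
    have SP: "SP n m = (\<lambda>C. r # C) ` SP (n - r) m \<union> (\<lambda>C. C @ [r]) ` SP (n - r) m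
        \<union> {us @ (c + m) # vs |us c vs. us @ c # vs \<in> SP (n - m) m \<and> c mod m = r}"
      using 3 assms(1) by (subst SP.simps) (simp add: Let_def r_def)
    have max_pow_r: "max_pow m r = 1" using r by (simp add: max_pow_not_dvd)
    \<comment> \<open>Next to parts divisible by \<open>m\<close>, the part \<open>r\<close> has the
      strictly smallest power, namely 1.\<close>
    have gt_1: "\<forall>x\<in>set (map (max_pow m) D). max_pow m r < x"
      if "\<forall>d\<in>set D. m dvd d" "set D \<subseteq> set C" for D
      using that max_pow_dvd_gt_1[OF assms(1)] pos max_pow_r by auto
    have IH_r: "D \<in> SP (n - r) m \<longleftrightarrow> distinct_unimodal (map (max_pow m) D)"
      if "C = r # D \<or> C = D @ [r]" for D
    proof (rule less.IH)
      show "composition_of (n - r) D" using that pos sum by (auto simp: composition_of_def)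
    qed (use r 3 in auto)
    \<comment> \<open>Both \<open>c\<close> and \<open>c + m\<close> have power 1, so the power
      sequence does not change. The residue \<open>r > 0\<close> rules out \<open>c = 0\<close>,
      which would not be a legal part.\<close>
    have IH_m: "us @ c # vs \<in> SP (n - m) m \<longleftrightarrow> distinct_unimodal (map (max_pow m) C)"
      if "C = us @ (c + m) # vs" "c mod m = r" for us c vs
    proof -
      have "c > 0" using that(2) r by (cases c) auto
      have "us @ c # vs \<in> SP (n - m) m \<longleftrightarrow> distinct_unimodal (map (max_pow m) (us @ c # vs))"
      proof (rule less.IH)
        show "composition_of (n - m) (us @ c # vs)"
          using that(1) pos sum \<open>c > 0\<close> by (auto simp: composition_of_def)
      qed (use 3 assms(1) in auto)
      moreover have "\<not> m dvd c" using that(2) r by auto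
      then have "max_pow m (c + m) = max_pow m c" by (simp add: max_pow_not_dvd)
      ultimately show ?thesis using that(1) by simp
    qed
    show ?thesis
    proof
      assume "C \<in> SP n m"
      then consider D where "C = r # D" "D \<in> SP (n - r) m"
        | D where "C = D @ [r]" "D \<in> SP (n - r) m"
        | us c vs where "C = us @ (c + m) # vs" "us @ c # vs \<in> SP (n - m) m" "c mod m = r"
        unfolding SP by blast
      then show "distinct_unimodal (map (max_pow m) C)"
      proof cases
        case (1 D)
        \<comment> \<open>Since \<open>m dvd n - r\<close>, the recursion itself guarantees that
          \<open>r\<close> is adjoined as a strict minimum.\<close>
        then have "\<forall>d\<in>set D. m dvd d" using SP_divisible_parts[OF 1(2) dvd] by blast
        then show ?thesis
          using 1 IH_r[of D] distinct_unimodal_Cons_less[OF gt_1[of D]] by auto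
      next
        case (2 D)
        then have "\<forall>d\<in>set D. m dvd d" using SP_divisible_parts[OF 2(2) dvd] by blast
        then show ?thesis
          using 2 IH_r[of D] distinct_unimodal_snoc_less[OF gt_1[of D]] by auto
      next
        case (3 us c vs)
        then show ?thesis using IH_m by blast
      qed
    next
      assume du: "distinct_unimodal (map (max_pow m) C)"
      then have dist: "distinct (map (max_pow m) C)" and uni: "unimodal (map (max_pow m) C)"
        by (auto simp: distinct_unimodal_def)
      from less.prems(2) dist show "C \<in> SP n m"
      proof (cases rule: distinct_max_pow_cases)
        case all_dvd
        then show ?thesis using 3 by simp
      next
        case (one_not_dvd us c vs)
        show ?thesis
        proof (cases "c < m")
          case True
          then have "c = r" using one_not_dvd(3) by (simp add: r_def)
          then have C: "C = us @ r # vs" using one_not_dvd(1) by simp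
          then have "us = [] \<or> vs = []"
            using unimodal_strict_min_at_end[of "map (max_pow m) us" "max_pow m r" "map (max_pow m) vs"]
              uni gt_1[of "us @ vs"] one_not_dvd(5) by auto
          then show ?thesis
          proof
            assume "us = []"
            then have C': "C = r # vs" using C by simp
            then have "distinct_unimodal (map (max_pow m) vs)"
              using du one_not_dvd(5) distinct_unimodal_Cons_less[OF gt_1[of vs]] by auto
            then show ?thesis using C' IH_r SP by blast
          next
            assume "vs = []"
            then have C': "C = us @ [r]" using C by simp
            then have "distinct_unimodal (map (max_pow m) us)"
              using du one_not_dvd(5) distinct_unimodal_snoc_less[OF gt_1[of us]] by auto
            then show ?thesis using C' IH_r SP by blast
          qed
        next
          case False
          \<comment> \<open>With \<open>c \<ge> m\<close> the natural-number subtraction is exact,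
            and \<open>c - m\<close> is the part to which the third branch of \<open>SP\<close> adds
            \<open>m\<close>.\<close>
          then have "C = us @ ((c - m) + m) # vs" "(c - m) mod m = r"
            using one_not_dvd(1,3) by (auto simp: r_def le_mod_geq)
          then show ?thesis using IH_m du SP by blast
        qed
      qed
    qed
  qed
qed

theorem theorem3p4:
  fixes m n :: nat and C :: "nat list"
  assumes "m > 1" and "n \<ge> 1" and "composition_of n C"
  shows "C \<in> SP n m \<longleftrightarrow>
    distinct (map (max_pow m) C) \<and> unimodal (map (max_pow m) C)"
  using SP_iff_distinct_unimodal[OF assms] by (simp add: distinct_unimodal_def)

end
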